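(* Let $\mathcal{H}$ be a Hilbert space and let $x,y\in\mathcal{H}$. If $T\in Q_{x\otimes y}$, then $x\otimes y$ majorizes $T$.
   Context: $\mathcal{B}(\mathcal{H})$ denotes the bounded linear operators on $\mathcal{H}$. The operator $x\otimes y$ is defined by $(x\otimes y)(h)=\langle h,y\rangle x$ for $h\in\mathcal{H}$. For $A\in\mathcal{B}(\mathcal{H})$ with spectral radius $r(A)$ and $m\ge 1$, put $d_m=\frac{1}{1/m+r(A)}$ and $R_m=R_m(A)=\left(\sum_{n=0}^\infty d_m^{2n}A^{*n}A^n\right)^{1/2}$, a positive invertible operator. Define $Q_A=\{S\in\mathcal{B}(\mathcal{H}):\|R_mSR_m^{-1}\|\to 0 \text{ as } m\to\infty\}$. For bounded operators $A,B$ on a Banach space $Y$, $A$ majorizes $B$ if there exists $M>0$ such that $\|Bz\|\le M\|Az\|$ for all $z\in Y$. *)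

theory Defs
  imports "HOL-Analysis.Analysis"
begin

(* HOL-Analysis only has real inner product spaces.  The inner product is linear in its
   first argument, and positive definiteness is implied by norm_eq_sqrt_cinner
   because norm is already a norm and sqrt is negative on negative numbers. *)
class complex_inner = real_normed_vector +
  fixes scaleC :: "complex \<Rightarrow> 'a \<Rightarrow> 'a"  (infixr "*\<^sub>C" 75)
    and cinner :: "'a \<Rightarrow> 'a \<Rightarrow> complex"
  assumes scaleC_add_right: "a *\<^sub>C (x + y) = a *\<^sub>C x + a *\<^sub>C y"
    and scaleC_add_left: "(a + b) *\<^sub>C x = a *\<^sub>C x + b *\<^sub>C x"
    and scaleC_scaleC: "a *\<^sub>C (b *\<^sub>C x) = (a * b) *\<^sub>C x"
    and scaleC_of_real: "complex_of_real r *\<^sub>C x = r *\<^sub>R x"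
    and cinner_commute: "cinner x y = cnj (cinner y x)"
    and cinner_add_left: "cinner (x + y) z = cinner x z + cinner y z"
    and cinner_scaleC_left: "cinner (a *\<^sub>C x) y = a * cinner x y"
    and norm_eq_sqrt_cinner: "norm x = sqrt (Re (cinner x x))"

class chilbert_space = complex_inner + complete_space

instance chilbert_space \<subseteq> banach ..

instantiation complex :: chilbert_space
begin

definition "a *\<^sub>C (z::complex) = a * z"

definition "cinner (z::complex) w = z * cnj w"

instance
  by standard
    (auto simp: scaleC_complex_def cinner_complex_def algebra_simps scaleR_conv_of_real cmod_def
        power2_eq_square)

end

lemma cinner_add_right: "cinner z (x + y) = cinner z x + cinner (z::'a::complex_inner) y"
  by (metis cinner_commute cinner_add_left complex_cnj_add)

lemma cinner_scaleC_right: "cinner x (a *\<^sub>C y) = cnj a * cinner (x::'a::complex_inner) y"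
  by (metis cinner_commute cinner_scaleC_left complex_cnj_mult)

lemma cinner_self: "cinner (x::'a::complex_inner) x = complex_of_real ((norm x)\<^sup>2)"
proof -
  have "0 \<le> Re (cinner x x)"
    using norm_ge_zero[of x] unfolding norm_eq_sqrt_cinner by simp
  then have "(norm x)\<^sup>2 = Re (cinner x x)"
    by (simp add: norm_eq_sqrt_cinner)
  moreover have "Im (cinner x x) = 0"
    using arg_cong[OF cinner_commute[of x x], of Im] by simp
  ultimately show ?thesis
    by (simp add: complex_eq_iff)
qed

lemma norm_scaleC: "norm (a *\<^sub>C x) = cmod a * norm (x::'a::complex_inner)"
proof -
  have "complex_of_real ((norm (a *\<^sub>C x))\<^sup>2) = (a * cnj a) * cinner x x"
    by (simp only: cinner_self[symmetric] cinner_scaleC_left cinner_scaleC_right ac_simps)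
  also have "\<dots> = complex_of_real ((cmod a * norm x)\<^sup>2)"
    by (simp add: cinner_self complex_norm_square[symmetric] power_mult_distrib)
  finally have "(norm (a *\<^sub>C x))\<^sup>2 = (cmod a * norm x)\<^sup>2"
    by (simp only: of_real_eq_iff)
  then show ?thesis
    by (simp add: power2_eq_iff_nonneg)
qed

lemma cinner_Cauchy_Schwarz: "cmod (cinner x y) \<le> norm x * norm (y::'a::complex_inner)"
proof (cases "cinner x y = 0")
  case False
  define c where "c = sgn (cinner x y)"
  have c: "cmod c = 1"
    using False by (simp add: c_def norm_sgn)
  have nc: "norm (c *\<^sub>C y) = norm y"
    by (simp add: norm_scaleC c)
  have "cinner x (c *\<^sub>C y) = cnj c * (c * cmod (cinner x y))"
    using False by (simp add: cinner_scaleC_right c_def sgn_div_norm scaleR_conv_of_real)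
  also have "\<dots> = (c * cnj c) * cmod (cinner x y)"
    by simp
  also have "\<dots> = cmod (cinner x y)"
    by (simp add: complex_norm_square[symmetric] c)
  finally have e: "cinner x (c *\<^sub>C y) = cmod (cinner x y)" .
  then have e': "cinner (c *\<^sub>C y) x = cmod (cinner x y)"
    by (metis cinner_commute complex_cnj_complex_of_real)
  have "complex_of_real ((norm (x + c *\<^sub>C y))\<^sup>2)
      = cinner x x + cinner x (c *\<^sub>C y) + (cinner (c *\<^sub>C y) x + cinner (c *\<^sub>C y) (c *\<^sub>C y))"
    by (simp only: cinner_self[symmetric] cinner_add_left cinner_add_right ac_simps)
  also have "\<dots> = complex_of_real ((norm x)\<^sup>2 + 2 * cmod (cinner x y) + (norm y)\<^sup>2)"
    by (simp add: e e' cinner_self nc)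
  finally have "complex_of_real ((norm (x + c *\<^sub>C y))\<^sup>2)
      = complex_of_real ((norm x)\<^sup>2 + 2 * cmod (cinner x y) + (norm y)\<^sup>2)" .
  then have "(norm (x + c *\<^sub>C y))\<^sup>2 = (norm x)\<^sup>2 + 2 * cmod (cinner x y) + (norm y)\<^sup>2"
    by (simp only: of_real_eq_iff)
  moreover have "(norm (x + c *\<^sub>C y))\<^sup>2 \<le> (norm x + norm y)\<^sup>2"
    using norm_triangle_ineq[of x "c *\<^sub>C y"] by (intro power_mono) (simp_all add: nc)
  ultimately show ?thesis
    by (simp add: power2_sum)
qed simp

lemma bounded_linear_scaleC: "bounded_linear (\<lambda>x::'a::complex_inner. a *\<^sub>C x)"
proof (rule bounded_linear_intro[where K = "cmod a"])
  fix r and x :: 'a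
  show "a *\<^sub>C (r *\<^sub>R x) = r *\<^sub>R (a *\<^sub>C x)"
    by (simp add: scaleC_of_real[symmetric] scaleC_scaleC mult.commute)
qed (simp_all add: scaleC_add_right norm_scaleC mult.commute)

lemma bounded_linear_rank_one:
  "bounded_linear (\<lambda>h::'a::complex_inner. cinner h y *\<^sub>C (x::'a))"
proof (rule bounded_linear_intro[where K = "norm y * norm x"])
  fix r and h :: 'a
  show "cinner (r *\<^sub>R h) y *\<^sub>C x = r *\<^sub>R (cinner h y *\<^sub>C x)"
    by (simp only: scaleC_of_real[symmetric] scaleC_scaleC cinner_scaleC_left)
  show "norm (cinner h y *\<^sub>C x) \<le> norm h * (norm y * norm x)"
    using mult_right_mono[OF cinner_Cauchy_Schwarz[of h y] norm_ge_zero[of x]]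
    by (simp add: norm_scaleC mult.assoc)
qed (simp add: cinner_add_left scaleC_add_left)

(* B(H): the library type of bounded operators only enforces real linearity. *)
definition bounded_ops :: "('a::chilbert_space \<Rightarrow>\<^sub>L 'a) set" where
  "bounded_ops = {A. \<forall>c x. blinfun_apply A (c *\<^sub>C x) = c *\<^sub>C blinfun_apply A x}"

lift_definition scalar_op :: "complex \<Rightarrow> ('a::chilbert_space \<Rightarrow>\<^sub>L 'a)"
  is "\<lambda>a x. a *\<^sub>C x"
  by (rule bounded_linear_scaleC)

lift_definition rank_one :: "'a::chilbert_space \<Rightarrow> 'a \<Rightarrow> ('a \<Rightarrow>\<^sub>L 'a)"  (infix "\<otimes>\<^sub>H" 75)
  is "\<lambda>x y h. cinner h y *\<^sub>C x"
  by (rule bounded_linear_rank_one)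

lemma rank_one_in_bounded_ops: "x \<otimes>\<^sub>H y \<in> bounded_ops"
  by (simp add: bounded_ops_def rank_one.rep_eq cinner_scaleC_left scaleC_scaleC)

primrec op_power :: "('a::chilbert_space \<Rightarrow>\<^sub>L 'a) \<Rightarrow> nat \<Rightarrow> ('a \<Rightarrow>\<^sub>L 'a)" where
  "op_power A 0 = id_blinfun"
| "op_power A (Suc n) = A o\<^sub>L op_power A n"

definition is_op_inverse :: "('a::chilbert_space \<Rightarrow>\<^sub>L 'a) \<Rightarrow> ('a \<Rightarrow>\<^sub>L 'a) \<Rightarrow> bool" where
  "is_op_inverse A B \<longleftrightarrow>
     B \<in> bounded_ops \<and> A o\<^sub>L B = id_blinfun \<and> B o\<^sub>L A = id_blinfun"

definition op_inverse :: "('a::chilbert_space \<Rightarrow>\<^sub>L 'a) \<Rightarrow> ('a \<Rightarrow>\<^sub>L 'a)" where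
  "op_inverse A = (THE B. is_op_inverse A B)"

definition op_spectrum :: "('a::chilbert_space \<Rightarrow>\<^sub>L 'a) \<Rightarrow> complex set" where
  "op_spectrum A = {a. \<nexists>B. is_op_inverse (A - scalar_op a) B}"

(* Inserting 0 has an effect only on the zero space, where the spectrum is empty. *)
definition spectral_radius :: "('a::chilbert_space \<Rightarrow>\<^sub>L 'a) \<Rightarrow> real" where
  "spectral_radius A = Sup (insert 0 (cmod ` op_spectrum A))"

definition op_adjoint :: "('a::chilbert_space \<Rightarrow>\<^sub>L 'a) \<Rightarrow> ('a \<Rightarrow>\<^sub>L 'a)" where
  "op_adjoint A = (THE B. B \<in> bounded_ops \<and> (\<forall>x y. cinner (A x) y = cinner x (blinfun_apply B y)))"

definition positive_op :: "('a::chilbert_space \<Rightarrow>\<^sub>L 'a) \<Rightarrow> bool" where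
  "positive_op A \<longleftrightarrow> A \<in> bounded_ops \<and> (\<forall>x. cinner (A x) x \<in> \<real>\<^sub>\<ge>\<^sub>0)"

definition op_sqrt :: "('a::chilbert_space \<Rightarrow>\<^sub>L 'a) \<Rightarrow> ('a \<Rightarrow>\<^sub>L 'a)" where
  "op_sqrt A = (THE B. positive_op B \<and> B o\<^sub>L B = A)"

definition d_coeff :: "('a::chilbert_space \<Rightarrow>\<^sub>L 'a) \<Rightarrow> nat \<Rightarrow> real" where
  "d_coeff A m = 1 / (1 / real m + spectral_radius A)"

definition R_op :: "('a::chilbert_space \<Rightarrow>\<^sub>L 'a) \<Rightarrow> nat \<Rightarrow> ('a \<Rightarrow>\<^sub>L 'a)" where
  "R_op A m =
     op_sqrt (\<Sum>n. d_coeff A m ^ (2 * n) *\<^sub>R (op_power (op_adjoint A) n o\<^sub>L op_power A n))"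

(* R_op A m is meant for m \<ge> 1; the value at m = 0 does not affect the limit. *)
definition Q_alg :: "('a::chilbert_space \<Rightarrow>\<^sub>L 'a) \<Rightarrow> ('a \<Rightarrow>\<^sub>L 'a) set" where
  "Q_alg A = {S \<in> bounded_ops.
     (\<lambda>m. norm (R_op A m o\<^sub>L S o\<^sub>L op_inverse (R_op A m))) \<longlonglongrightarrow> 0}"

definition majorizes ::
  "('b::real_normed_vector \<Rightarrow>\<^sub>L 'b) \<Rightarrow> ('b \<Rightarrow>\<^sub>L 'b) \<Rightarrow> bool" where
  "majorizes A B \<longleftrightarrow> (\<exists>M>0. \<forall>z. norm (B z) \<le> M * norm (A z))"

end

theory Submission
  imports Defs
begin

text \<open>
  Write \<open>A = x \<otimes> y\<close> and \<open>s = \<langle>x, y\<rangle>\<close>. An operator is majorized by the rank-one operator \<open>A\<close> as soon as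
  it vanishes on the kernel of \<open>A\<close>, because it is then determined by its value at \<open>y\<close>
  (\<open>majorizes_rank_oneI\<close>). So the point is that every \<open>T \<in> Q_alg A\<close> kills \<open>y\<^sup>\<bottom>\<close>.

  Since \<open>A\<^sup>*\<^sup>n A\<^sup>n\<close> is a multiple of \<open>y \<otimes> y\<close> for \<open>n \<ge> 1\<close>, the series under the square root sums to
  \<open>I + c (y \<otimes> y)\<close> with \<open>c \<ge> 0\<close>. It converges because \<open>s\<close> is a spectral value of \<open>A\<close> (if \<open>x \<noteq> 0\<close>),
  hence \<open>d\<^sub>m \<bar>s\<bar> < 1\<close>. Its positive square root has the same shape, so
  \<open>R\<^sub>m = I + t (y \<otimes> y)\<close> with \<open>t \<ge> 0\<close> (\<open>R_op_rank_one\<close>).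
  This operator does not decrease norms, and it fixes every \<open>z \<bottom> y\<close>, as does its inverse. Therefore
  \<open>\<parallel>T z\<parallel> \<le> \<parallel>R\<^sub>m T z\<parallel> = \<parallel>R\<^sub>m T R\<^sub>m\<^sup>-\<^sup>1 z\<parallel> \<le> \<parallel>R\<^sub>m T R\<^sub>m\<^sup>-\<^sup>1\<parallel> \<parallel>z\<parallel>\<close>, and the right-hand side
  tends to \<open>0\<close> (\<open>Q_alg_rank_one_vanishes\<close>).

  If \<open>x = 0\<close>, the kernel of \<open>A\<close> is the whole space instead of \<open>y\<^sup>\<bottom>\<close>; but then \<open>A = 0 \<otimes> 0\<close>, and the argument
  applies with \<open>0\<close> in place of \<open>y\<close>.
\<close>

lemma scaleC_zero_right [simp]: "a *\<^sub>C (0::'a::complex_inner) = 0"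
  using norm_scaleC[of a "0::'a"] by simp

lemma scaleC_zero_left [simp]: "0 *\<^sub>C (x::'a::complex_inner) = 0"
  using norm_scaleC[of 0 x] by simp

lemma scaleC_one [simp]: "1 *\<^sub>C (x::'a::complex_inner) = x"
  using scaleC_of_real[of 1 x] by simp

lemma scaleC_eq_0_iff: "a *\<^sub>C (x::'a::complex_inner) = 0 \<longleftrightarrow> a = 0 \<or> x = 0"
  using norm_scaleC[of a x] by (metis mult_eq_0_iff norm_eq_zero)

lemma scaleC_minus_left: "(- a) *\<^sub>C (x::'a::complex_inner) = - (a *\<^sub>C x)"
  using scaleC_add_left[of a "- a" x] by (simp add: eq_neg_iff_add_eq_0 add.commute)

lemma scaleR_scaleC_eq: "r *\<^sub>R (a *\<^sub>C x) = (of_real r * a) *\<^sub>C (x::'a::complex_inner)"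
  by (metis scaleC_of_real scaleC_scaleC)

lemma cinner_zero_left [simp]: "cinner 0 (y::'a::complex_inner) = 0"
  using cinner_add_left[of 0 0 y] by simp

lemma cinner_zero_right [simp]: "cinner (y::'a::complex_inner) 0 = 0"
  using cinner_add_right[of y 0 0] by simp

lemma cinner_minus_left: "cinner (- x) (y::'a::complex_inner) = - cinner x y"
  using cinner_add_left[of x "- x" y] by (simp add: eq_neg_iff_add_eq_0 add.commute)

lemma cinner_diff_left: "cinner (x - z) (y::'a::complex_inner) = cinner x y - cinner z y"
  using cinner_add_left[of x "- z" y] by (simp add: cinner_minus_left)

lemma cinner_scaleR_left: "cinner (r *\<^sub>R x) (y::'a::complex_inner) = of_real r * cinner x y"
  by (metis cinner_scaleC_left scaleC_of_real)

lemma cinner_diff_right: "cinner y (x - z) = cinner (y::'a::complex_inner) x - cinner y z"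
  by (metis cinner_commute cinner_diff_left complex_cnj_diff)

section \<open>Rank-one operators\<close>

lemma rank_one_zero_left: "0 \<otimes>\<^sub>H y = 0"
  by (rule blinfun_eqI) (simp add: rank_one.rep_eq)

lemma op_power_rank_one_Suc_apply:
  "op_power (x \<otimes>\<^sub>H y) (Suc n) h = (cinner x y ^ n * cinner h y) *\<^sub>C x"
  by (induction n) (simp_all add: rank_one.rep_eq cinner_scaleC_left mult_ac)

lemma op_adjoint_rank_one: "op_adjoint (x \<otimes>\<^sub>H y) = y \<otimes>\<^sub>H x"
  unfolding op_adjoint_def
proof (rule the_equality)
  show *: "y \<otimes>\<^sub>H x \<in> bounded_ops \<and> (\<forall>u v. cinner ((x \<otimes>\<^sub>H y) u) v = cinner u ((y \<otimes>\<^sub>H x) v))"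
    unfolding rank_one.rep_eq cinner_scaleC_left cinner_scaleC_right 
    by (metis rank_one_in_bounded_ops cinner_commute mult.commute)
  fix B
  assume B: "B \<in> bounded_ops \<and> (\<forall>u v. cinner ((x \<otimes>\<^sub>H y) u) v = cinner u (blinfun_apply B v))"
  show "B = y \<otimes>\<^sub>H x"
  proof (rule blinfun_eqI)
    fix v
    let ?w = "blinfun_apply B v - (y \<otimes>\<^sub>H x) v"
    have "cinner ?w ?w = 0"
      by (subst cinner_diff_right) (metis B * right_minus_eq)
    then show "blinfun_apply B v = (y \<otimes>\<^sub>H x) v"
      by (simp add: cinner_self)
  qed
qed

lemma op_inverseI:
  assumes "is_op_inverse A B"
  shows "op_inverse A = B"
  unfolding op_inverse_def
proof (rule the_equality)
  show "is_op_inverse A B"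
    by (rule assms)
  fix C assume C: "is_op_inverse A C"
  show "C = B"
  proof (rule blinfun_eqI)
    fix h
    have "blinfun_apply C (A (blinfun_apply B h)) = blinfun_apply C h"
      using assms by (metis is_op_inverse_def blinfun_apply_blinfun_compose blinfun_apply_id_blinfun)
    moreover have "blinfun_apply C (A (blinfun_apply B h)) = blinfun_apply B h"
      using C by (metis is_op_inverse_def blinfun_apply_blinfun_compose blinfun_apply_id_blinfun)
    ultimately show "blinfun_apply C h = blinfun_apply B h"
      by simp
  qed
qed

text \<open>The relation \<open>A\<^sup>2 = s A\<close> with \<open>s = \<langle>x, y\<rangle>\<close> makes \<open>A - a\<close> invertible within the span of
  \<open>I\<close> and \<open>A\<close> whenever \<open>a \<notin> {0, s}\<close>. The bound is what makes the supremum in the spectral radius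
  a genuine one.\<close>

lemma op_spectrum_rank_one_subset: "op_spectrum (x \<otimes>\<^sub>H y) \<subseteq> {0, cinner x y}"
proof
  fix a assume a: "a \<in> op_spectrum (x \<otimes>\<^sub>H y)"
  show "a \<in> {0, cinner x y}"
  proof (rule ccontr)
    assume "a \<notin> {0, cinner x y}"
    then have a0: "a \<noteq> 0" and sa: "cinner x y - a \<noteq> 0"
      by auto
    \<comment> \<open>The coefficients solve \<open>(A - a) (\<alpha> I + \<beta> A) = I\<close>, that is, \<open>- a \<alpha> = 1\<close> and
      \<open>\<alpha> + (s - a) \<beta> = 0\<close>.\<close>
    define \<alpha> where "\<alpha> = - 1 / a"
    define \<beta> where "\<beta> = 1 / (a * (cinner x y - a))"
    define B where "B = scalar_op \<alpha> + (scalar_op \<beta> o\<^sub>L (x \<otimes>\<^sub>H y))"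
    have app: "blinfun_apply B h = \<alpha> *\<^sub>C h + (\<beta> * cinner h y) *\<^sub>C x" for h
      by (simp add: B_def blinfun.add_left scalar_op.rep_eq rank_one.rep_eq scaleC_scaleC)
    have B: "B \<in> bounded_ops"
      by (simp add: bounded_ops_def app scaleC_add_right scaleC_scaleC cinner_scaleC_left mult_ac)
    have app': "((x \<otimes>\<^sub>H y) - scalar_op a) h = cinner h y *\<^sub>C x + (- a) *\<^sub>C h" for h
      by (simp add: blinfun.diff_left scalar_op.rep_eq rank_one.rep_eq scaleC_minus_left)
    have \<alpha>: "(- a) * \<alpha> = 1"
      using a0 by (simp add: \<alpha>_def)
    have \<beta>: "\<alpha> + \<beta> * (cinner x y - a) = 0"
      using a0 sa by (simp add: \<alpha>_def \<beta>_def field_simps)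
    have \<beta>': "(\<alpha> * u + \<beta> * u * cinner x y) + (- a) * (\<beta> * u) = 0" for u
      using arg_cong[OF \<beta>, of "\<lambda>v. v * u"] by (simp add: algebra_simps)
    have "((x \<otimes>\<^sub>H y) - scalar_op a) o\<^sub>L B = id_blinfun"
    proof (rule blinfun_eqI)
      fix h
      have "(((x \<otimes>\<^sub>H y) - scalar_op a) o\<^sub>L B) h =
          ((\<alpha> * cinner h y + \<beta> * cinner h y * cinner x y) + (- a) * (\<beta> * cinner h y)) *\<^sub>C x +
          ((- a) * \<alpha>) *\<^sub>C h"
        by (simp only: blinfun_apply_blinfun_compose app app' scaleC_add_right scaleC_add_left
            scaleC_scaleC cinner_add_left cinner_scaleC_left distrib_left ac_simps)
      then show "(((x \<otimes>\<^sub>H y) - scalar_op a) o\<^sub>L B) h = id_blinfun h"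
        unfolding \<beta>' \<alpha> by simp
    qed
    moreover have "B o\<^sub>L ((x \<otimes>\<^sub>H y) - scalar_op a) = id_blinfun"
    proof (rule blinfun_eqI)
      fix h
      have "(B o\<^sub>L ((x \<otimes>\<^sub>H y) - scalar_op a)) h =
          ((\<alpha> * cinner h y + \<beta> * cinner h y * cinner x y) + (- a) * (\<beta> * cinner h y)) *\<^sub>C x +
          ((- a) * \<alpha>) *\<^sub>C h"
        by (simp only: blinfun_apply_blinfun_compose app app' scaleC_add_right scaleC_add_left
            scaleC_scaleC cinner_add_left cinner_scaleC_left distrib_left ac_simps)
      then show "(B o\<^sub>L ((x \<otimes>\<^sub>H y) - scalar_op a)) h = id_blinfun h"
        unfolding \<beta>' \<alpha> by simp
    qed
    ultimately show False
      using a B unfolding op_spectrum_def is_op_inverse_def by blast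
  qed
qed

lemma spectral_radius_rank_one_ge: "cmod (cinner x y) \<le> spectral_radius (x \<otimes>\<^sub>H y)"
proof -
  have bdd: "bdd_above (insert 0 (cmod ` op_spectrum (x \<otimes>\<^sub>H y)))"
    using finite_subset[OF op_spectrum_rank_one_subset, of x y] by (intro bdd_above_finite) auto
  have "cmod (cinner x y) \<in> insert 0 (cmod ` op_spectrum (x \<otimes>\<^sub>H y))"
  proof (cases "x = 0")
    case False
    \<comment> \<open>\<open>x\<close> is an eigenvector.\<close>
    have ker: "((x \<otimes>\<^sub>H y) - scalar_op (cinner x y)) x = 0"
      by (simp add: blinfun.diff_left scalar_op.rep_eq rank_one.rep_eq)
    have "\<not> is_op_inverse ((x \<otimes>\<^sub>H y) - scalar_op (cinner x y)) B" for B
    proof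
      assume "is_op_inverse ((x \<otimes>\<^sub>H y) - scalar_op (cinner x y)) B"
      then have "(B o\<^sub>L ((x \<otimes>\<^sub>H y) - scalar_op (cinner x y))) x = x"
        by (simp add: is_op_inverse_def)
      then show False
        using ker False by (simp add: blinfun.zero_right)
    qed
    then show ?thesis
      by (auto simp: op_spectrum_def)
  qed simp
  then show ?thesis
    unfolding spectral_radius_def using bdd by (rule cSup_upper)
qed

text \<open>Modulo \<open>ker A\<close> the space is spanned by \<open>y\<close>: for \<open>x \<noteq> 0\<close> and \<open>y \<noteq> 0\<close>, the vector
  \<open>z - (\<langle>z, y\<rangle> / \<parallel>y\<parallel>\<^sup>2) y\<close> lies in that kernel.\<close>

lemma majorizes_rank_oneI:
  assumes ker: "\<And>z. (x \<otimes>\<^sub>H y) z = 0 \<Longrightarrow> blinfun_apply T z = 0"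
  shows "majorizes (x \<otimes>\<^sub>H y) T"
proof (cases "x = 0 \<or> y = 0")
  case True
  then have "blinfun_apply T z = 0" for z
    by (intro ker) (auto simp: rank_one.rep_eq)
  then show ?thesis
    by (auto simp: majorizes_def intro!: exI[of _ 1])
next
  case False
  define M where "M = norm T / (norm x * norm y) + 1"
  have "M > 0"
    by (simp add: M_def add_nonneg_pos)
  moreover have "norm (blinfun_apply T z) \<le> M * norm ((x \<otimes>\<^sub>H y) z)" for z
  proof -
    define p where "p = (cinner z y / of_real ((norm y)\<^sup>2)) *\<^sub>C y"
    have "cinner (z - p) y = 0"
      using False by (simp add: p_def cinner_diff_left cinner_scaleC_left cinner_self)
    then have "blinfun_apply T (z - p) = 0"
      by (intro ker) (simp add: rank_one.rep_eq)
    then have "norm (blinfun_apply T z) = norm (blinfun_apply T p)"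
      by (simp add: blinfun.diff_right)
    also have "\<dots> \<le> norm T * norm p"
      by (rule norm_blinfun)
    also have "\<dots> = norm T / (norm x * norm y) * norm ((x \<otimes>\<^sub>H y) z)"
      using False by (simp add: p_def norm_scaleC norm_divide rank_one.rep_eq power2_eq_square
          norm_mult)
    also have "\<dots> \<le> M * norm ((x \<otimes>\<^sub>H y) z)"
      by (intro mult_right_mono) (simp_all add: M_def)
    finally show ?thesis .
  qed
  ultimately show ?thesis
    unfolding majorizes_def by blast
qed

section \<open>Rank-one perturbations of the identity\<close>

definition rank_one_perturbation :: "real \<Rightarrow> 'a::chilbert_space \<Rightarrow> ('a \<Rightarrow>\<^sub>L 'a)" where
  "rank_one_perturbation t y = id_blinfun + t *\<^sub>R (y \<otimes>\<^sub>H y)"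

lemma rank_one_perturbation_apply:
  "rank_one_perturbation t y h = h + (of_real t * cinner h y) *\<^sub>C y"
  by (simp add: rank_one_perturbation_def blinfun.add_left blinfun.scaleR_left rank_one.rep_eq
      scaleR_scaleC_eq)

lemma rank_one_perturbation_fixes_orthogonal:
  assumes "cinner z y = 0"
  shows "rank_one_perturbation t y z = z"
  using assms by (simp add: rank_one_perturbation_apply)

lemma rank_one_perturbation_in_bounded_ops: "rank_one_perturbation t y \<in> bounded_ops"
  by (simp add: bounded_ops_def rank_one_perturbation_apply scaleC_add_right scaleC_scaleC
      cinner_scaleC_left mult_ac)

lemma rank_one_perturbation_compose:
  "rank_one_perturbation s y o\<^sub>L rank_one_perturbation t y =
   rank_one_perturbation (s + t + s * t * (norm y)\<^sup>2) y"
proof (rule blinfun_eqI)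
  fix h
  show "(rank_one_perturbation s y o\<^sub>L rank_one_perturbation t y) h =
      rank_one_perturbation (s + t + s * t * (norm y)\<^sup>2) y h"
    by (simp add: rank_one_perturbation_apply cinner_add_left cinner_scaleC_left cinner_self
        scaleC_add_left[symmetric] add.assoc) (simp add: algebra_simps)
qed

lemma rank_one_perturbation_0: "rank_one_perturbation 0 y = id_blinfun"
  by (simp add: rank_one_perturbation_def)

lemma is_op_inverse_rank_one_perturbation:
  assumes "t \<ge> 0"
  shows "is_op_inverse (rank_one_perturbation t y)
           (rank_one_perturbation (- t / (1 + t * (norm y)\<^sup>2)) y)"
proof -
  have "1 + t * (norm y)\<^sup>2 > 0"
    using assms by (intro add_pos_nonneg) auto
  then have e: "t + u + t * u * (norm y)\<^sup>2 = 0" if "u = - t / (1 + t * (norm y)\<^sup>2)" for u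
    unfolding that by (simp add: field_simps)
  show ?thesis
    unfolding is_op_inverse_def rank_one_perturbation_compose
    using e[OF refl] by (simp add: rank_one_perturbation_in_bounded_ops rank_one_perturbation_0
        ac_simps)
qed

lemma cinner_rank_one_perturbation:
  "cinner (rank_one_perturbation t y v) v = of_real ((norm v)\<^sup>2 + t * (cmod (cinner v y))\<^sup>2)"
  unfolding rank_one_perturbation_apply cinner_add_left cinner_scaleC_left cinner_self
    cinner_commute[of y v]
  by (simp add: complex_norm_square[symmetric] mult.assoc)

lemma positive_rank_one_perturbation:
  assumes "t \<ge> 0"
  shows "positive_op (rank_one_perturbation t y)"
  using assms unfolding positive_op_def cinner_rank_one_perturbation
  by (auto simp: rank_one_perturbation_in_bounded_ops simp del: of_real_add)

lemma norm_rank_one_perturbation_ge: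
  assumes "t \<ge> 0"
  shows "norm v \<le> norm (rank_one_perturbation t y v)"
proof -
  have "norm v * norm v \<le> (norm v)\<^sup>2 + t * (cmod (cinner v y))\<^sup>2"
    using assms by (simp add: power2_eq_square)
  also have "\<dots> \<le> cmod (cinner (rank_one_perturbation t y v) v)"
    unfolding cinner_rank_one_perturbation norm_of_real by simp
  also have "\<dots> \<le> norm (rank_one_perturbation t y v) * norm v"
    by (rule cinner_Cauchy_Schwarz)
  finally show ?thesis
    by (cases "v = 0") auto
qed

text \<open>Let \<open>R\<close> be the claimed root of \<open>K\<close> and \<open>B\<close> another one. As \<open>R\<close> is an affine function of
  \<open>K = B\<^sup>2\<close>, it commutes with \<open>B\<close>, whence \<open>(B + R) (B - R) = 0\<close>. Pairing this with \<open>w = (B - R) v\<close>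
  gives \<open>\<langle>B w, w\<rangle> + \<langle>R w, w\<rangle> = 0\<close>, and the left-hand side is at least \<open>\<parallel>w\<parallel>\<^sup>2\<close>.\<close>

lemma op_sqrt_rank_one_perturbation_square:
  assumes t: "t \<ge> 0"
  shows "op_sqrt (rank_one_perturbation (2 * t + t\<^sup>2 * (norm y)\<^sup>2) y) = rank_one_perturbation t y"
  unfolding op_sqrt_def
proof (rule the_equality)
  let ?c = "2 * t + t\<^sup>2 * (norm y)\<^sup>2"
  let ?K = "rank_one_perturbation ?c y"
  let ?R = "rank_one_perturbation t y"
  have RR: "?R o\<^sub>L ?R = ?K"
    by (simp add: rank_one_perturbation_compose power2_eq_square)
  then show "positive_op ?R \<and> ?R o\<^sub>L ?R = ?K"
    using t by (simp add: positive_rank_one_perturbation)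
  fix B :: "'a \<Rightarrow>\<^sub>L 'a"
  assume B: "positive_op B \<and> B o\<^sub>L B = ?K"
  have comm: "blinfun_apply B (?R v) = ?R (blinfun_apply B v)" for v
  proof (cases "t = 0")
    case False
    then have c: "?c > 0"
      using t by (intro add_pos_nonneg) auto
    have K: "?K h = blinfun_apply B (blinfun_apply B h)" for h
      using B by (metis blinfun_apply_blinfun_compose)
    have e: "t = t / ?c * ?c"
      using c by simp
    have R: "?R h = h + (t / ?c) *\<^sub>R (?K h - h)" for h
      by (subst e) (simp only: rank_one_perturbation_apply scaleR_scaleC_eq add_diff_cancel_left'
          of_real_mult mult.assoc)
    show ?thesis
      unfolding R K by (simp add: blinfun.add_right blinfun.diff_right blinfun.scaleR_right)
  qed (simp add: rank_one_perturbation_0)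
  show "B = ?R"
  proof (rule blinfun_eqI)
    fix v
    define w where "w = blinfun_apply B v - ?R v"
    have "blinfun_apply B w + ?R w = (B o\<^sub>L B) v - (?R o\<^sub>L ?R) v"
      by (simp add: w_def blinfun.diff_right comm)
    also have "\<dots> = 0"
      using B RR by simp
    finally have "cinner (blinfun_apply B w) w + cinner (?R w) w = 0"
      by (metis cinner_add_left cinner_zero_left)
    then have "Re (cinner (blinfun_apply B w) w) + ((norm w)\<^sup>2 + t * (cmod (cinner w y))\<^sup>2) = 0"
      unfolding cinner_rank_one_perturbation
      by (metis Re_complex_of_real plus_complex.sel(1) zero_complex.sel(1))
    moreover have "Re (cinner (blinfun_apply B w) w) \<ge> 0"
      using B by (auto simp: positive_op_def complex_nonneg_Reals_iff)
    moreover have "t * (cmod (cinner w y))\<^sup>2 \<ge> 0"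
      using t by simp
    ultimately have "(norm w)\<^sup>2 \<le> 0"
      by linarith
    then show "blinfun_apply B v = ?R v"
      by (simp add: w_def)
  qed
qed

section \<open>The operators \<open>R\<^sub>m\<close> of a rank-one operator\<close>

lemma op_power_adjoint_rank_one_compose:
  "op_power (op_adjoint (x \<otimes>\<^sub>H y)) (Suc n) o\<^sub>L op_power (x \<otimes>\<^sub>H y) (Suc n) =
   ((norm x)\<^sup>2 * (cmod (cinner x y))\<^sup>2 ^ n) *\<^sub>R (y \<otimes>\<^sub>H y)"
proof (rule blinfun_eqI)
  fix h
  have s: "cinner y x ^ n * cinner x y ^ n = of_real ((cmod (cinner x y))\<^sup>2 ^ n)"
    unfolding cinner_commute[of y x] of_real_power[of _ n] complex_norm_square
    by (simp add: power_mult_distrib mult.commute)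
  have "(op_power (op_adjoint (x \<otimes>\<^sub>H y)) (Suc n) o\<^sub>L op_power (x \<otimes>\<^sub>H y) (Suc n)) h =
      ((cinner y x ^ n * cinner x y ^ n) * (cinner x x * cinner h y)) *\<^sub>C y"
    unfolding op_adjoint_rank_one blinfun_apply_blinfun_compose op_power_rank_one_Suc_apply
      cinner_scaleC_left by (simp only: mult_ac)
  also have "\<dots> = (((norm x)\<^sup>2 * (cmod (cinner x y))\<^sup>2 ^ n) *\<^sub>R (y \<otimes>\<^sub>H y)) h"
    unfolding s cinner_self by (simp add: blinfun.scaleR_left rank_one.rep_eq scaleR_scaleC_eq mult_ac)
  finally show "(op_power (op_adjoint (x \<otimes>\<^sub>H y)) (Suc n) o\<^sub>L op_power (x \<otimes>\<^sub>H y) (Suc n)) h =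
      (((norm x)\<^sup>2 * (cmod (cinner x y))\<^sup>2 ^ n) *\<^sub>R (y \<otimes>\<^sub>H y)) h" .
qed

text \<open>The series is the identity plus a geometric series of ratio \<open>(d\<^sub>m \<bar>\<langle>x, y\<rangle>\<bar>)\<^sup>2\<close> times
  \<open>y \<otimes> y\<close>. The term \<open>1 / m\<close> in \<open>d\<^sub>m\<close> keeps the ratio strictly below \<open>1\<close>.\<close>

lemma R_op_series_rank_one:
  assumes m: "m \<ge> 1"
  obtains c where "c \<ge> 0"
    "(\<lambda>n. d_coeff (x \<otimes>\<^sub>H y) m ^ (2 * n) *\<^sub>R
        (op_power (op_adjoint (x \<otimes>\<^sub>H y)) n o\<^sub>L op_power (x \<otimes>\<^sub>H y) n))
     sums rank_one_perturbation c y"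
proof -
  let ?d = "d_coeff (x \<otimes>\<^sub>H y) m"
  let ?s = "cmod (cinner x y)"
  let ?f = "\<lambda>n. ?d ^ (2 * n) *\<^sub>R
    (op_power (op_adjoint (x \<otimes>\<^sub>H y)) n o\<^sub>L op_power (x \<otimes>\<^sub>H y) n)"
  define q where "q = (?d * ?s)\<^sup>2"
  have "?s < 1 / real m + spectral_radius (x \<otimes>\<^sub>H y)"
    using m spectral_radius_rank_one_ge[of x y]
    by (intro add_strict_increasing) auto
  moreover from this have "1 / real m + spectral_radius (x \<otimes>\<^sub>H y) > 0"
    by (rule le_less_trans[OF norm_ge_zero])
  ultimately have "0 \<le> ?d * ?s" "?d * ?s < 1"
    by (simp_all add: d_coeff_def)
  then have q: "0 \<le> q" "q < 1"
    by (auto simp: q_def power_less_one_iff abs_square_less_1)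
  define c where "c = (?d * norm x)\<^sup>2 * (1 / (1 - q))"
  have "(\<lambda>n. ((?d * norm x)\<^sup>2 * q ^ n) *\<^sub>R (y \<otimes>\<^sub>H y)) sums (c *\<^sub>R (y \<otimes>\<^sub>H y))"
    unfolding c_def using q by (intro sums_scaleR_left sums_mult geometric_sums) auto
  moreover have "?f (Suc n) = ((?d * norm x)\<^sup>2 * q ^ n) *\<^sub>R (y \<otimes>\<^sub>H y)" for n
    unfolding op_power_adjoint_rank_one_compose
    by (simp add: q_def power_mult_distrib power_mult power2_eq_square mult_ac)
  ultimately have "(\<lambda>n. ?f (Suc n)) sums (c *\<^sub>R (y \<otimes>\<^sub>H y))"
    by simp
  then have "?f sums (c *\<^sub>R (y \<otimes>\<^sub>H y) + ?f 0)"
    by (rule sums_Suc)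
  moreover have "c *\<^sub>R (y \<otimes>\<^sub>H y) + ?f 0 = rank_one_perturbation c y"
    by (rule blinfun_eqI) (simp add: rank_one_perturbation_def blinfun.add_left)
  ultimately have "?f sums rank_one_perturbation c y"
    by simp
  moreover have "c \<ge> 0"
    using q by (simp add: c_def)
  ultimately show thesis
    using that by blast
qed

lemma R_op_rank_one:
  assumes "m \<ge> 1"
  obtains t where "t \<ge> 0" "R_op (x \<otimes>\<^sub>H y) m = rank_one_perturbation t y"
proof -
  obtain c where c: "c \<ge> 0" and sums:
    "(\<lambda>n. d_coeff (x \<otimes>\<^sub>H y) m ^ (2 * n) *\<^sub>R
        (op_power (op_adjoint (x \<otimes>\<^sub>H y)) n o\<^sub>L op_power (x \<otimes>\<^sub>H y) n))
     sums rank_one_perturbation c y"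
    using R_op_series_rank_one[OF assms] .
  define r where "r = sqrt (1 + c * (norm y)\<^sup>2)"
  \<comment> \<open>The eigenvalue at \<open>y\<close> must be \<open>1 + t \<parallel>y\<parallel>\<^sup>2 = r\<close>; this form of the solution \<open>t\<close> also makes sense
    for \<open>y = 0\<close>.\<close>
  define t where "t = c / (1 + r)"
  have r: "r \<ge> 0" "r\<^sup>2 = 1 + c * (norm y)\<^sup>2"
    using c by (simp_all add: r_def)
  have t: "t \<ge> 0"
    using c r by (simp add: t_def)
  have "t * (norm y)\<^sup>2 = r - 1"
  proof -
    have "c * (norm y)\<^sup>2 = (r - 1) * (1 + r)"
      using r(2) by (simp add: algebra_simps power2_eq_square)
    then show ?thesis
      using r(1) by (simp add: t_def)
  qed
  moreover have "2 * t + t\<^sup>2 * (norm y)\<^sup>2 = t * (2 + t * (norm y)\<^sup>2)"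
    by (simp add: algebra_simps power2_eq_square)
  ultimately have "2 * t + t\<^sup>2 * (norm y)\<^sup>2 = t * (1 + r)"
    by simp
  also have "\<dots> = c"
    using r(1) by (simp add: t_def)
  finally have "op_sqrt (rank_one_perturbation c y) = rank_one_perturbation t y"
    using op_sqrt_rank_one_perturbation_square[OF t, of y] by simp
  then have "R_op (x \<otimes>\<^sub>H y) m = rank_one_perturbation t y"
    unfolding R_op_def using sums_unique[OF sums] by simp
  then show thesis
    using that t by blast
qed

lemma Q_alg_rank_one_vanishes:
  assumes T: "T \<in> Q_alg (x \<otimes>\<^sub>H y)" and z: "cinner z y = 0"
  shows "blinfun_apply T z = 0"
proof -
  let ?R = "R_op (x \<otimes>\<^sub>H y)"
  have bound: "norm (blinfun_apply T z) \<le> norm (?R m o\<^sub>L T o\<^sub>L op_inverse (?R m)) * norm z"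
    if "m \<ge> 1" for m
  proof -
    obtain t where t: "t \<ge> 0" and R: "?R m = rank_one_perturbation t y"
      using R_op_rank_one[OF \<open>m \<ge> 1\<close>] .
    have inv: "op_inverse (?R m) z = z"
      unfolding R op_inverseI[OF is_op_inverse_rank_one_perturbation[OF t]]
      using z by (rule rank_one_perturbation_fixes_orthogonal)
    have "norm (blinfun_apply T z) \<le> norm (?R m (blinfun_apply T z))"
      unfolding R by (rule norm_rank_one_perturbation_ge[OF t])
    also have "\<dots> = norm ((?R m o\<^sub>L T o\<^sub>L op_inverse (?R m)) z)"
      by (simp add: inv)
    also have "\<dots> \<le> norm (?R m o\<^sub>L T o\<^sub>L op_inverse (?R m)) * norm z"
      by (rule norm_blinfun)
    finally show ?thesis .
  qed
  have "(\<lambda>m. norm (?R m o\<^sub>L T o\<^sub>L op_inverse (?R m)) * norm z) \<longlonglongrightarrow> 0"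
    using T by (intro tendsto_mult_left_zero) (simp add: Q_alg_def)
  then have "norm (blinfun_apply T z) \<le> 0"
    by (rule tendsto_lowerbound)
      (use bound in \<open>auto simp: eventually_sequentially intro!: exI[of _ 1]\<close>)
  then show ?thesis
    by simp
qed

theorem proposition2p22:
  fixes x y :: "'a::chilbert_space"
    and T :: "'a \<Rightarrow>\<^sub>L 'a"
  assumes "T \<in> Q_alg (x \<otimes>\<^sub>H y)"
  shows "majorizes (x \<otimes>\<^sub>H y) T"
proof (rule majorizes_rank_oneI)
  fix z assume z: "(x \<otimes>\<^sub>H y) z = 0"
  show "blinfun_apply T z = 0"
  proof (cases "x = 0")
    case True
    then have "T \<in> Q_alg (0 \<otimes>\<^sub>H 0)"
      using assms by (simp add: rank_one_zero_left)
    then show ?thesis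
      by (rule Q_alg_rank_one_vanishes) simp
  next
    case False
    then have "cinner z y = 0"
      using z by (simp add: rank_one.rep_eq scaleC_eq_0_iff)
    then show ?thesis
      by (rule Q_alg_rank_one_vanishes[OF assms])
  qed
qed

end
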